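(* Let $A$ be an $n\times n$ consensus matrix whose communication graph has connectivity $k$. Then there exist a set $K\subseteq V=\{1,\dots,n\}$ with $|K|=k$ and an undetectable input $u_K:\mathbb{N}\to\mathbb{R}^{k}$ for the system $x(t+1)=Ax(t)+B_Ku_K(t)$ such that all agents in $K$ are misbehaving.
   Context: $\mathbb{N}=\{0,1,2,\dots\}$. A consensus matrix is a real square matrix that is row stochastic (nonnegative entries, rows summing to one) and primitive. Its communication graph is the directed graph on $V=\{1,\dots,n\}$ with edge $(j,i)$ if and only if $A_{ij}\neq 0$; the neighbor set of $j$ is $N_j=\{i\in V:(i,j)\in E\}$. A vertex cutset is a set $S\subset V$ such that $V\setminus S$ can be partitioned into two nonempty sets $V_1,V_3$ with no edge from $V_3$ to $V_1$; the connectivity of the graph is the minimum number of vertices in a vertex cutset (in particular such a cutset exists). For $K=\{i_1,i_2,\dots\}\subseteq V$, $B_K=[e_{i_1}\ e_{i_2}\ \cdots]$ with $e_i$ the canonical basis vectors. For $j\in V$ with $N_j=\{n_1,\dots,n_p\}$, $C_j=[e_{n_1}\ \cdots\ e_{n_p}]^{\mathsf T}$, and $y_j(x_0,u_K,t)=C_jx(t)$ is the output of node $j$ at time $t$ for initial state $x(0)=x_0$ and input $u_K$. An input $u_K$ is undetectable if there exist $x_1,x_2\in\mathbb{R}^n$ and $j\in V$ with $y_j(x_1,u_K,t)=y_j(x_2,0,t)$ for all $t\in\mathbb{N}$. An agent $i\in K$ is misbehaving if its input component $u_i(t)$ is nonzero for some $t\in\mathbb{N}$. *)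

theory Defs
  imports
    Complex_Main
    "Jordan_Normal_Form.Matrix"
    "Graph_Theory.Pair_Digraph"
begin

(* Indices are 0-based throughout, as in Jordan_Normal_Form.Matrix: the agents of an
   n x n system are {0..<n}. *)

definition row_stochastic_mat :: "real mat \<Rightarrow> bool" where
  "row_stochastic_mat A \<longleftrightarrow>
     (\<forall>i < dim_row A. \<forall>j < dim_col A. 0 \<le> A $$ (i, j)) \<and>
     (\<forall>i < dim_row A. (\<Sum>j < dim_col A. A $$ (i, j)) = 1)"

definition primitive_mat :: "real mat \<Rightarrow> bool" where
  "primitive_mat A \<longleftrightarrow>
     square_mat A \<and>
     (\<forall>i < dim_row A. \<forall>j < dim_row A. 0 \<le> A $$ (i, j)) \<and>
     (\<exists>m \<ge> 1. \<forall>i < dim_row A. \<forall>j < dim_row A. 0 < (A ^\<^sub>m m) $$ (i, j))"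

definition consensus_matrix :: "real mat \<Rightarrow> bool" where
  "consensus_matrix A \<longleftrightarrow> square_mat A \<and> row_stochastic_mat A \<and> primitive_mat A"

definition communication_graph :: "real mat \<Rightarrow> nat pair_pre_digraph" where
  "communication_graph A =
     \<lparr> pverts = {0..<dim_row A},
       parcs = {(j, i). j < dim_row A \<and> i < dim_row A \<and> A $$ (i, j) \<noteq> 0} \<rparr>"

definition neighbors :: "'a pair_pre_digraph \<Rightarrow> 'a \<Rightarrow> 'a set" where
  "neighbors G j = {i \<in> pverts G. (i, j) \<in> parcs G}"

definition vertex_cutset :: "'a pair_pre_digraph \<Rightarrow> 'a set \<Rightarrow> bool" where
  "vertex_cutset G S \<longleftrightarrow>
     S \<subset> pverts G \<and>
     (\<exists>V1 V3. V1 \<noteq> {} \<and> V3 \<noteq> {} \<and> V1 \<inter> V3 = {} \<and> V1 \<union> V3 = pverts G - S \<and>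
        (\<forall>a \<in> V3. \<forall>b \<in> V1. (a, b) \<notin> parcs G))"

(* Meaningful only for a finite graph that has a vertex cutset (Min {} is unspecified). *)
definition connectivity :: "'a pair_pre_digraph \<Rightarrow> nat" where
  "connectivity G = Min (card ` {S. vertex_cutset G S})"

(* The elements of K are listed in increasing order; this fixes which column of the input
   matrix, and so which component of the input, belongs to which agent of K. *)
definition input_mat :: "nat \<Rightarrow> nat set \<Rightarrow> real mat" where
  "input_mat n K = mat_of_cols n (map (unit_vec n) (sorted_list_of_set K))"

definition output_mat :: "real mat \<Rightarrow> nat \<Rightarrow> real mat" where
  "output_mat A j =
     mat_of_rows (dim_row A)
       (map (unit_vec (dim_row A))
         (sorted_list_of_set (neighbors (communication_graph A) j)))"

primrec state :: "real mat \<Rightarrow> nat set \<Rightarrow> real vec \<Rightarrow> (nat \<Rightarrow> real vec) \<Rightarrow> nat \<Rightarrow> real vec" where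
  "state A K x0 u 0 = x0"
| "state A K x0 u (Suc t) = A *\<^sub>v state A K x0 u t + input_mat (dim_row A) K *\<^sub>v u t"

definition node_output ::
    "real mat \<Rightarrow> nat set \<Rightarrow> nat \<Rightarrow> real vec \<Rightarrow> (nat \<Rightarrow> real vec) \<Rightarrow> nat \<Rightarrow> real vec" where
  "node_output A K j x0 u t = output_mat A j *\<^sub>v state A K x0 u t"

definition undetectable :: "real mat \<Rightarrow> nat set \<Rightarrow> (nat \<Rightarrow> real vec) \<Rightarrow> bool" where
  "undetectable A K u \<longleftrightarrow>
     (\<exists>x1 \<in> carrier_vec (dim_row A). \<exists>x2 \<in> carrier_vec (dim_row A). \<exists>j < dim_row A.
        \<forall>t. node_output A K j x1 u t = node_output A K j x2 (\<lambda>_. 0\<^sub>v (card K)) t)"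

definition misbehaving :: "nat set \<Rightarrow> (nat \<Rightarrow> real vec) \<Rightarrow> nat \<Rightarrow> bool" where
  "misbehaving K u i \<longleftrightarrow>
     (\<exists>p < card K. sorted_list_of_set K ! p = i \<and> (\<exists>t. u t $ p \<noteq> 0))"

end

(* Let S be a minimum cutset, with no edge from V3 to V1. Starting from the indicator vector of V3,
   let the agents of S inject exactly minus what they receive from V3: the state then stays zero on
   V1 and S, so an observer in V1, all of whose neighbors lie in V1 or S, sees what it would see from
   the zero state without input. An agent of S receiving nothing from V3 could be moved to V1, which
   would shrink the cutset; by nonnegativity of A, every agent of S therefore has a nonzero input
   at time 0. *)
theory Submission
  imports Defs
begin

text \<open>\<open>Min\<close> returns an actual member only for a finite nonempty set. Cutsets are
  subsets of the finite vertex set, so there are finitely many, and one exists by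
  assumption.\<close>

lemma connectivity_attained:
  assumes "finite (pverts G)" and "\<exists>S. vertex_cutset G S"
  obtains S where "vertex_cutset G S" "card S = connectivity G"
    "\<And>T. vertex_cutset G T \<Longrightarrow> card S \<le> card T"
proof -
  have "{S. vertex_cutset G S} \<subseteq> Pow (pverts G)"
    by (auto simp: vertex_cutset_def)
  then have fin: "finite (card ` {S. vertex_cutset G S})"
    using assms(1) by (meson finite_Pow_iff finite_imageI finite_subset)
  have "connectivity G \<in> card ` {S. vertex_cutset G S}"
    unfolding connectivity_def using fin assms(2) by (intro Min_in) auto
  moreover have "connectivity G \<le> card T" if "vertex_cutset G T" for T
    unfolding connectivity_def using fin that by (intro Min_le) auto
  ultimately show ?thesis
    using that by (metis (mono_tags, lifting) imageE mem_Collect_eq)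
qed

text \<open>If nothing in \<open>V3\<close> points to \<open>i\<close>, then \<open>i\<close> may
  join \<open>V1\<close>, and \<open>S - {i}\<close> is a cutset smaller than \<open>S\<close>. The
  edge obtained here is what later forces a nonzero input at \<open>i\<close>.\<close>

lemma minimum_cutset_in_edge:
  assumes fin: "finite (pverts G)"
    and min: "\<And>T. vertex_cutset G T \<Longrightarrow> card S \<le> card T"
    and S: "S \<subseteq> pverts G" "V1 \<noteq> {}" "V3 \<noteq> {}" "V1 \<inter> V3 = {}" "V1 \<union> V3 = pverts G - S"
    and no_edge: "\<And>a b. a \<in> V3 \<Longrightarrow> b \<in> V1 \<Longrightarrow> (a, b) \<notin> parcs G"
    and i: "i \<in> S"
  shows "\<exists>a \<in> V3. (a, i) \<in> parcs G"
proof (rule ccontr)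
  assume no_in: "\<not> ?thesis"
  have "vertex_cutset G (S - {i})"
    unfolding vertex_cutset_def
  proof (intro conjI exI)
    show "S - {i} \<subset> pverts G"
      using S(1) i by blast
    show "insert i V1 \<noteq> {}" "V3 \<noteq> {}"
      using S(3) by auto
    show "insert i V1 \<inter> V3 = {}"
      using S(4,5) i by blast
    show "insert i V1 \<union> V3 = pverts G - (S - {i})"
      using S(1,5) i by blast
    show "\<forall>a\<in>V3. \<forall>b\<in>insert i V1. (a, b) \<notin> parcs G"
      using no_in no_edge by blast
  qed
  from min[OF this] show False
    using i fin S(1) by (metis card_Diff1_less finite_subset not_le)
qed

lemma input_mat_carrier: "input_mat n K \<in> carrier_mat n (card K)"
  by (rule carrier_matI) (simp_all add: input_mat_def)

text \<open>Row \<open>i\<close> of the input matrix marks the positions at which the enumeration of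
  \<open>K\<close> holds \<open>i\<close>. This form serves both agents outside \<open>K\<close>,
  where no term survives, and agents in \<open>K\<close>, where exactly one does.\<close>

lemma input_mat_mult_index:
  assumes "v \<in> carrier_vec (card K)" "i < n"
  shows "(input_mat n K *\<^sub>v v) $ i =
    (\<Sum>p < card K. if sorted_list_of_set K ! p = i then v $ p else 0)"
proof -
  have "input_mat n K $$ (i, p) * v $ p = (if sorted_list_of_set K ! p = i then v $ p else 0)"
    if "p < card K" for p
    using that assms(2) by (simp add: input_mat_def mat_of_cols_index unit_vec_def)
  moreover have "(input_mat n K *\<^sub>v v) $ i = (\<Sum>p < card K. input_mat n K $$ (i, p) * v $ p)"
    using assms input_mat_carrier[of n K]
    by (simp add: scalar_prod_def atLeast0LessThan)
  ultimately show ?thesis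
    by simp
qed

lemma input_mat_mult_index_notin:
  assumes "finite K" "v \<in> carrier_vec (card K)" "i < n" "i \<notin> K"
  shows "(input_mat n K *\<^sub>v v) $ i = 0"
proof -
  have "sorted_list_of_set K ! p \<noteq> i" if "p < card K" for p
    using that assms(1,4) by (metis nth_mem set_sorted_list_of_set sorted_list_of_set.length_sorted_key_list_of_set)
  then show ?thesis
    using assms by (simp add: input_mat_mult_index)
qed

lemma input_mat_mult_index_nth:
  assumes "v \<in> carrier_vec (card K)" "p < card K" "sorted_list_of_set K ! p < n"
  shows "(input_mat n K *\<^sub>v v) $ (sorted_list_of_set K ! p) = v $ p"
proof -
  \<comment> \<open>The enumeration has no repetitions, so equality of agents is equality of
    positions and one term remains.\<close>
  have "(input_mat n K *\<^sub>v v) $ (sorted_list_of_set K ! p) =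
      (\<Sum>q < card K. if q = p then v $ q else 0)"
    unfolding input_mat_mult_index[OF assms(1,3)] using assms(2)
    by (intro sum.cong) (auto simp: nth_eq_iff_index_eq)
  then show ?thesis
    using assms(2) by simp
qed

lemma input_mat_mult_zero: "input_mat n K *\<^sub>v 0\<^sub>v (card K) = 0\<^sub>v n"
  using input_mat_carrier[of n K] by (intro eq_vecI) auto

lemma state_zero:
  assumes "A \<in> carrier_mat n n"
  shows "state A K (0\<^sub>v n) (\<lambda>_. 0\<^sub>v (card K)) t = 0\<^sub>v n"
  using assms by (induction t) (auto simp: input_mat_mult_zero)

text \<open>Each row of the output matrix is the unit vector of a neighbor of \<open>j\<close>, so
  multiplying by it only reads coordinates at neighbors.\<close>

lemma output_mat_mult_eq:
  assumes A: "A \<in> carrier_mat n n" and v: "v \<in> carrier_vec n" and w: "w \<in> carrier_vec n"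
    and eq: "\<And>i. i \<in> neighbors (communication_graph A) j \<Longrightarrow> v $ i = w $ i"
  shows "output_mat A j *\<^sub>v v = output_mat A j *\<^sub>v w"
proof (rule eq_vecI)
  let ?N = "neighbors (communication_graph A) j"
  have N: "finite ?N" "?N \<subseteq> {0..<n}"
    using A by (auto simp: neighbors_def communication_graph_def)
  fix p assume "p < dim_vec (output_mat A j *\<^sub>v w)"
  then have p: "p < card ?N"
    by (simp add: output_mat_def)
  let ?i = "sorted_list_of_set ?N ! p"
  have i: "?i \<in> ?N"
    using p N(1) by (metis nth_mem set_sorted_list_of_set sorted_list_of_set.length_sorted_key_list_of_set)
  then have "?i < n"
    using N(2) by auto
  then show "(output_mat A j *\<^sub>v v) $ p = (output_mat A j *\<^sub>v w) $ p"
    using p A v w eq[OF i] by (simp add: output_mat_def)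
qed (simp add: output_mat_def)

text \<open>The input is a state feedback, but \<open>state\<close> takes the whole input as an
  argument. To avoid this circularity, the closed-loop trajectory \<open>z\<close> is built first
  without any input, \<open>u\<close> is read off from it, and \<open>state\<close> is then shown to
  follow \<open>z\<close>.\<close>

lemma cutset_attack_state:
  fixes A :: "real mat"
  assumes A: "A \<in> carrier_mat n n"
    and K: "K \<subseteq> {0..<n}" and V: "V1 \<union> V3 = {0..<n} - K"
    and A13: "\<And>i a. i \<in> V1 \<Longrightarrow> a \<in> V3 \<Longrightarrow> A $$ (i, a) = 0"
    and z0: "z0 \<in> carrier_vec n" "\<And>i. i < n \<Longrightarrow> i \<notin> V3 \<Longrightarrow> z0 $ i = 0"
  obtains u where "\<And>t. u t \<in> carrier_vec (card K)"
    "\<And>p. p < card K \<Longrightarrow> u 0 $ p = - (A *\<^sub>v z0) $ (sorted_list_of_set K ! p)"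
    "\<And>t. state A K z0 u t \<in> carrier_vec n"
    "\<And>t i. i < n \<Longrightarrow> i \<notin> V3 \<Longrightarrow> state A K z0 u t $ i = 0"
proof -
  \<comment> \<open>The closed loop: apply \<open>A\<close>, then erase every coordinate outside
    \<open>V3\<close>.\<close>
  define f where "f v = vec n (\<lambda>i. if i \<in> V3 then (A *\<^sub>v v) $ i else 0)" for v :: "real vec"
  define z where "z t = (f ^^ t) z0" for t
  define u where "u t = vec (card K) (\<lambda>p. - (A *\<^sub>v z t) $ (sorted_list_of_set K ! p))" for t
  have z: "z t \<in> carrier_vec n" "i < n \<Longrightarrow> i \<notin> V3 \<Longrightarrow> z t $ i = 0" for t i
    using z0 by (cases t; simp add: z_def f_def)+
  have u: "u t \<in> carrier_vec (card K)" for t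
    by (simp add: u_def)
  have finK: "finite K"
    using K finite_subset by blast
  have step: "A *\<^sub>v z t + input_mat n K *\<^sub>v u t = f (z t)" for t
  proof (rule eq_vecI)
    fix i assume "i < dim_vec (f (z t))"
    then have i: "i < n"
      by (simp add: f_def)
    have "i \<in> V1 \<union> V3 \<longleftrightarrow> i \<notin> K"
      using i unfolding V by simp
    then consider "i \<in> V3" "i \<notin> K" | "i \<in> V1" "i \<notin> K" "i \<notin> V3" | "i \<in> K" "i \<notin> V3"
      by blast
    then have "(A *\<^sub>v z t) $ i + (input_mat n K *\<^sub>v u t) $ i = f (z t) $ i"
    proof cases
      case 1
      then show ?thesis
        using i u finK by (simp add: f_def input_mat_mult_index_notin)
    next
      case 2
      \<comment> \<open>For \<open>a\<close> in \<open>V3\<close> the entry of \<open>A\<close>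
        vanishes; for any other \<open>a\<close> the coordinate of \<open>z t\<close> does.\<close>
      have "A $$ (i, a) * z t $ a = 0" if "a < n" for a
        using A13[of i a] 2 z(2)[of a t] that by (cases "a \<in> V3") auto
      then have "(A *\<^sub>v z t) $ i = 0"
        using A i z(1)[of t] by (auto simp: scalar_prod_def intro!: sum.neutral)
      then show ?thesis
        using 2 i u finK by (simp add: f_def input_mat_mult_index_notin)
    next
      case 3
      then obtain p where p: "p < card K" "sorted_list_of_set K ! p = i"
        using finK by (metis in_set_conv_nth set_sorted_list_of_set
            sorted_list_of_set.length_sorted_key_list_of_set)
      have "(input_mat n K *\<^sub>v u t) $ i = - (A *\<^sub>v z t) $ i"
        using input_mat_mult_index_nth[OF u p(1), of n t] p i by (simp add: u_def)
      then show ?thesis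
        using 3 i by (simp add: f_def)
    qed
    then show "(A *\<^sub>v z t + input_mat n K *\<^sub>v u t) $ i = f (z t) $ i"
      using i input_mat_carrier[of n K] by simp
  qed (use input_mat_carrier[of n K] in \<open>simp add: f_def\<close>)
  have "state A K z0 u t = z t" for t
    using A step by (induction t) (auto simp: z_def)
  then show ?thesis
    using that[of u] u z by (simp add: u_def z_def)
qed

theorem mainTheorem2:
  fixes A :: "real mat" and n k :: nat
  assumes "A \<in> carrier_mat n n"
    and "consensus_matrix A"
    and "\<exists>S. vertex_cutset (communication_graph A) S"
    and "connectivity (communication_graph A) = k"
  shows "\<exists>(K :: nat set) (u :: nat \<Rightarrow> real vec).
           K \<subseteq> {0..<n} \<and> card K = k \<and>
           (\<forall>t. u t \<in> carrier_vec k) \<and>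
           undetectable A K u \<and>
           (\<forall>i \<in> K. misbehaving K u i)"
proof -
  let ?G = "communication_graph A"
  have dim: "dim_row A = n" "dim_col A = n"
    using assms(1) by auto
  have verts: "pverts ?G = {0..<n}"
    by (simp add: communication_graph_def dim)
  have nonneg: "0 \<le> A $$ (i, j)" if "i < n" "j < n" for i j
    using assms(2) that by (simp add: consensus_matrix_def row_stochastic_mat_def dim)
  obtain K where cut: "vertex_cutset ?G K" and card: "card K = k"
    and min: "\<And>T. vertex_cutset ?G T \<Longrightarrow> card K \<le> card T"
    using connectivity_attained[of ?G] assms(3,4) verts by (metis finite_atLeastLessThan)
  have K: "K \<subseteq> {0..<n}"
    using cut by (simp add: vertex_cutset_def verts psubset_eq)
  obtain V1 V3 where ne: "V1 \<noteq> {}" "V3 \<noteq> {}"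
    and V: "V1 \<inter> V3 = {}" "V1 \<union> V3 = {0..<n} - K"
    and "\<forall>a\<in>V3. \<forall>b\<in>V1. (a, b) \<notin> parcs ?G"
    using cut[unfolded vertex_cutset_def verts] by (elim conjE exE)
  then have no_edge: "(a, b) \<notin> parcs ?G" if "a \<in> V3" "b \<in> V1" for a b
    using that by simp
  have lt: "i < n" if "i \<in> V1 \<union> V3" for i
    using V(2) that by auto
  \<comment> \<open>Indices swap here: the edge \<open>(a, i)\<close> stands for the entry at
    \<open>(i, a)\<close>.\<close>
  have A13: "A $$ (i, a) = 0" if "i \<in> V1" "a \<in> V3" for i a
    using no_edge[OF that(2,1)] lt that by (auto simp: communication_graph_def dim)
  define z0 :: "real vec" where "z0 = vec n (\<lambda>i. if i \<in> V3 then 1 else 0)"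
  have z0: "z0 \<in> carrier_vec n" "\<And>i. i < n \<Longrightarrow> i \<notin> V3 \<Longrightarrow> z0 $ i = 0"
    by (auto simp: z0_def)
  obtain u where u: "\<And>t. u t \<in> carrier_vec (card K)"
    and u0: "\<And>p. p < card K \<Longrightarrow> u 0 $ p = - (A *\<^sub>v z0) $ (sorted_list_of_set K ! p)"
    and st: "\<And>t. state A K z0 u t \<in> carrier_vec n"
      "\<And>t i. i < n \<Longrightarrow> i \<notin> V3 \<Longrightarrow> state A K z0 u t $ i = 0"
    using cutset_attack_state[OF assms(1) K V(2) A13 z0] by blast
  have "undetectable A K u"
  proof -
    obtain j where j: "j \<in> V1"
      using ne by blast
    \<comment> \<open>The attacked run is compared with the run that starts at zero and receives no
      input, which stays at zero.\<close>
    have "node_output A K j z0 u t = node_output A K j (0\<^sub>v n) (\<lambda>_. 0\<^sub>v (card K)) t" for t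
      unfolding node_output_def state_zero[OF assms(1)]
    proof (rule output_mat_mult_eq[OF assms(1) st(1)])
      fix i assume "i \<in> neighbors ?G j"
      \<comment> \<open>A neighbor of \<open>j\<close> sends an edge into \<open>V1\<close>, so it
        cannot lie in \<open>V3\<close>; off \<open>V3\<close> the attacked state is zero.\<close>
      then have "i < n" "i \<notin> V3"
        using no_edge[OF _ j] by (auto simp: neighbors_def verts)
      then show "state A K z0 u t $ i = 0\<^sub>v n $ i"
        using st(2) by simp
    qed simp
    moreover have "j < n"
      using j lt by blast
    ultimately show ?thesis
      unfolding undetectable_def dim using z0(1) by (metis zero_carrier_vec)
  qed
  moreover have "misbehaving K u i" if i: "i \<in> K" for i
  proof -
    have i_lt: "i < n"
      using K i by auto
    obtain a where a: "a \<in> V3" "(a, i) \<in> parcs ?G"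
      using minimum_cutset_in_edge[OF _ min _ ne V(1) _ no_edge i] K V(2) verts by auto
    have "(A *\<^sub>v z0) $ i = (\<Sum>b\<in>{0..<n}. A $$ (i, b) * z0 $ b)"
      using i_lt z0(1) by (simp add: scalar_prod_def dim)
    \<comment> \<open>No term is negative, so nothing can cancel the term at \<open>a\<close>, which
      is positive because the edge makes \<open>A $$ (i, a)\<close> nonzero and \<open>z0\<close> is
      1 on \<open>V3\<close>.\<close>
    also have "\<dots> > 0"
    proof (rule sum_pos2)
      show "a \<in> {0..<n}"
        using a lt by auto
      show "0 < A $$ (i, a) * z0 $ a"
        using a nonneg[OF i_lt, of a] by (auto simp: communication_graph_def dim z0_def)
      show "0 \<le> A $$ (i, b) * z0 $ b" if "b \<in> {0..<n}" for b
        using that nonneg[OF i_lt] by (auto simp: z0_def)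
    qed simp
    finally have pos: "(A *\<^sub>v z0) $ i > 0" .
    have "finite K"
      using K finite_subset by blast
    then obtain p where p: "p < card K" "sorted_list_of_set K ! p = i"
      using i by (metis in_set_conv_nth set_sorted_list_of_set
          sorted_list_of_set.length_sorted_key_list_of_set)
    then have "u 0 $ p \<noteq> 0"
      using u0[OF p(1)] pos by simp
    then show ?thesis
      unfolding misbehaving_def using p by blast
  qed
  ultimately show ?thesis
    using K card u by metis
qed

end
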